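(* Let $(\Lambda,d)$ be a row-finite $k$-graph with no sources, and let $p\in\mathbb{N}^k$. Let $\{s_\lambda:\lambda\in\Lambda\}$ be the universal generating Cuntz-Krieger $\Lambda$-family in $C^*(\Lambda)$ and $\{t_\lambda:\lambda\in p\Lambda\}$ the universal generating Cuntz-Krieger $p\Lambda$-family in $C^*(p\Lambda)$. For $\lambda\in p\Lambda$ put $r_\lambda:=s_\lambda s_{s_p(\lambda)}^*$. Then there is an isomorphism $\phi:C^*(p\Lambda)\to C^*(\Lambda)$ such that $\phi(t_\lambda)=r_\lambda$ for all $\lambda\in p\Lambda$.
   Context: A $k$-graph is a pair $(\Lambda,d)$ where $\Lambda$ is a countable category and $d:\Lambda\to\mathbb{N}^k$ is a functor satisfying the factorisation property: if $d(\lambda)=m+n$ then there are unique $\mu\in d^{-1}(m)$, $\nu\in d^{-1}(n)$ with $\lambda=\mu\nu$. Vertices are identified with paths of degree $0$; $r,s$ are codomain and domain; $\Lambda^n:=d^{-1}(n)$, and for a vertex $v$, $v\Lambda^n:=\{\lambda\in\Lambda^n:r(\lambda)=v\}$. $\Lambda$ is row-finite if $v\Lambda^n$ is finite for all vertices $v$ and $n\in\mathbb{N}^k$, and has no sources if $v\Lambda^n\neq\emptyset$ for all $v,n$. For $d(\lambda)=n$ and $l\le m\le n$, $\lambda(l,m)$ is the unique path of degree $m-l$ with $\lambda=\lambda(0,l)\lambda(l,m)\lambda(m,n)$. The dual $k$-graph $p\Lambda$ has paths $\{\lambda:d(\lambda)\ge p\}$, vertices $\Lambda^p$, range $r_p(\lambda)=\lambda(0,p)$,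 source $s_p(\lambda)=\lambda(d(\lambda)-p,d(\lambda))$, composition $\lambda\circ_p\mu=\lambda\,\mu(p,d(\mu))$ when $s_p(\lambda)=r_p(\mu)$, degree $d_p(\lambda)=d(\lambda)-p$; it is row-finite with no sources when $\Lambda$ is. For a row-finite $k$-graph $\Gamma$ with no sources, a Cuntz-Krieger $\Gamma$-family is a collection $\{t_\lambda:\lambda\in\Gamma\}$ of partial isometries such that (i) $\{t_v:v\in\Gamma^0\}$ are mutually orthogonal projections; (ii) $t_\lambda t_\mu=t_{\lambda\mu}$ when $s(\lambda)=r(\mu)$; (iii) $t_\lambda^*t_\lambda=t_{s(\lambda)}$; (iv) $t_v=\sum_{\lambda\in v\Gamma^n}t_\lambda t_\lambda^*$ for all $v\in\Gamma^0$, $n\in\mathbb{N}^k$. $C^*(\Gamma)$ is the $C^*$-algebra generated by a Cuntz-Krieger $\Gamma$-family that is universal for such families. *)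

theory Defs
  imports Complex_Main "HOL-Library.Countable_Set"
begin

class cstar_algebra = real_normed_algebra + banach +
  fixes cscale :: "complex \<Rightarrow> 'a \<Rightarrow> 'a"
    and adj :: "'a \<Rightarrow> 'a"
  assumes cscale_of_real: "cscale (complex_of_real r) x = scaleR r x"
    and cscale_add_right: "cscale c (x + y) = cscale c x + cscale c y"
    and cscale_add_left: "cscale (b + c) x = cscale b x + cscale c x"
    and cscale_cscale: "cscale b (cscale c x) = cscale (b * c) x"
    and norm_cscale: "norm (cscale c x) = cmod c * norm x"
    and mult_cscale_left: "cscale c x * y = cscale c (x * y)"
    and mult_cscale_right: "x * cscale c y = cscale c (x * y)"
    and adj_adj: "adj (adj x) = x"
    and adj_add: "adj (x + y) = adj x + adj y"
    and adj_mult: "adj (x * y) = adj y * adj x"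
    and adj_cscale: "adj (cscale c x) = cscale (cnj c) (adj x)"
    and cstar_identity: "norm (adj x * x) = norm x * norm x"

definition star_hom :: "('a::cstar_algebra \<Rightarrow> 'b::cstar_algebra) \<Rightarrow> bool" where
  "star_hom f \<longleftrightarrow>
     (\<forall>x y. f (x + y) = f x + f y) \<and>
     (\<forall>x y. f (x * y) = f x * f y) \<and>
     (\<forall>c x. f (cscale c x) = cscale c (f x)) \<and>
     (\<forall>x. f (adj x) = adj (f x))"

definition cstar_gen :: "'a::cstar_algebra set \<Rightarrow> 'a set" where
  "cstar_gen S = \<Inter>{B. S \<subseteq> B \<and> closed B \<and>
      (\<forall>x\<in>B. \<forall>y\<in>B. x + y \<in> B \<and> x * y \<in> B) \<and>
      (\<forall>c. \<forall>x\<in>B. cscale c x \<in> B) \<and> (\<forall>x\<in>B. adj x \<in> B)}"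

text \<open>Degrees are elements of N^k, represented as functions nat => nat vanishing from k on.\<close>
definition nk :: "nat \<Rightarrow> (nat \<Rightarrow> nat) set" where
  "nk k = {n. \<forall>i\<ge>k. n i = 0}"

record 'p kgraph =
  paths :: "'p set"
  rng :: "'p \<Rightarrow> 'p"
  src :: "'p \<Rightarrow> 'p"
  cmp :: "'p \<Rightarrow> 'p \<Rightarrow> 'p"
  deg :: "'p \<Rightarrow> nat \<Rightarrow> nat"

text \<open>Vertices (objects, identified with identity morphisms) are the paths of degree 0.\<close>
definition verts :: "'p kgraph \<Rightarrow> 'p set" where
  "verts G = {v \<in> paths G. deg G v = (\<lambda>_. 0)}"

definition is_kgraph :: "nat \<Rightarrow> 'p kgraph \<Rightarrow> bool" where
  "is_kgraph k G \<longleftrightarrow>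
     countable (paths G) \<and>
     (\<forall>l\<in>paths G. deg G l \<in> nk k \<and> rng G l \<in> verts G \<and> src G l \<in> verts G) \<and>
     (\<forall>v\<in>verts G. rng G v = v \<and> src G v = v) \<and>
     (\<forall>l\<in>paths G. cmp G (rng G l) l = l \<and> cmp G l (src G l) = l) \<and>
     (\<forall>l\<in>paths G. \<forall>m\<in>paths G. src G l = rng G m \<longrightarrow>
        cmp G l m \<in> paths G \<and> rng G (cmp G l m) = rng G l \<and> src G (cmp G l m) = src G m \<and>
        deg G (cmp G l m) = (\<lambda>i. deg G l i + deg G m i)) \<and>
     (\<forall>l\<in>paths G. \<forall>m\<in>paths G. \<forall>n\<in>paths G. src G l = rng G m \<longrightarrow> src G m = rng G n \<longrightarrow>
        cmp G (cmp G l m) n = cmp G l (cmp G m n)) \<and>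
     (\<forall>l\<in>paths G. \<forall>a b. deg G l = (\<lambda>i. a i + b i) \<longrightarrow>
        (\<exists>!q. case q of (mu, nu) \<Rightarrow> mu \<in> paths G \<and> nu \<in> paths G \<and> deg G mu = a \<and> deg G nu = b \<and>
                src G mu = rng G nu \<and> l = cmp G mu nu))"

definition row_finite :: "nat \<Rightarrow> 'p kgraph \<Rightarrow> bool" where
  "row_finite k G \<longleftrightarrow> (\<forall>v\<in>verts G. \<forall>n\<in>nk k.
      finite {l \<in> paths G. deg G l = n \<and> rng G l = v})"

definition no_sources :: "nat \<Rightarrow> 'p kgraph \<Rightarrow> bool" where
  "no_sources k G \<longleftrightarrow> (\<forall>v\<in>verts G. \<forall>n\<in>nk k.
      {l \<in> paths G. deg G l = n \<and> rng G l = v} \<noteq> {})"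

text \<open>The segment l(a,b) for a <= b <= d(l).\<close>
definition seg :: "'p kgraph \<Rightarrow> 'p \<Rightarrow> (nat \<Rightarrow> nat) \<Rightarrow> (nat \<Rightarrow> nat) \<Rightarrow> 'p" where
  "seg G l a b = (THE nu. \<exists>al be. al \<in> paths G \<and> nu \<in> paths G \<and> be \<in> paths G \<and>
      deg G al = a \<and> deg G nu = (\<lambda>i. b i - a i) \<and> deg G be = (\<lambda>i. deg G l i - b i) \<and>
      src G al = rng G nu \<and> src G nu = rng G be \<and> l = cmp G (cmp G al nu) be)"

definition dual :: "'p kgraph \<Rightarrow> (nat \<Rightarrow> nat) \<Rightarrow> 'p kgraph" where
  "dual G p = \<lparr> paths = {l \<in> paths G. \<forall>i. p i \<le> deg G l i},
      rng = (\<lambda>l. seg G l (\<lambda>_. 0) p),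
      src = (\<lambda>l. seg G l (\<lambda>i. deg G l i - p i) (deg G l)),
      cmp = (\<lambda>l m. cmp G l (seg G m p (deg G m))),
      deg = (\<lambda>l i. deg G l i - p i) \<rparr>"

definition CK_family :: "nat \<Rightarrow> 'p kgraph \<Rightarrow> ('p \<Rightarrow> 'a::cstar_algebra) \<Rightarrow> bool" where
  "CK_family k G t \<longleftrightarrow>
     (\<forall>l\<in>paths G. t l * adj (t l) * t l = t l) \<and>
     (\<forall>v\<in>verts G. adj (t v) = t v \<and> t v * t v = t v) \<and>
     (\<forall>v\<in>verts G. \<forall>w\<in>verts G. v \<noteq> w \<longrightarrow> t v * t w = 0) \<and>
     (\<forall>l\<in>paths G. \<forall>m\<in>paths G. src G l = rng G m \<longrightarrow> t (cmp G l m) = t l * t m) \<and>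
     (\<forall>l\<in>paths G. adj (t l) * t l = t (src G l)) \<and>
     (\<forall>v\<in>verts G. \<forall>n\<in>nk k.
        t v = (\<Sum>l\<in>{l \<in> paths G. deg G l = n \<and> rng G l = v}. t l * adj (t l)))"

definition universal_CK ::
  "nat \<Rightarrow> 'p kgraph \<Rightarrow> ('p \<Rightarrow> 'a::cstar_algebra) \<Rightarrow> 'c::cstar_algebra itself \<Rightarrow> bool" where
  "universal_CK k G t _ \<longleftrightarrow> CK_family k G t \<and> cstar_gen (t ` paths G) = UNIV \<and>
     (\<forall>q :: 'p \<Rightarrow> 'c. CK_family k G q \<longrightarrow>
        (\<exists>\<pi> :: 'a \<Rightarrow> 'c. star_hom \<pi> \<and> (\<forall>l\<in>paths G. \<pi> (t l) = q l)))"

end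

theory Submission
  imports Defs "HOL-Analysis.Elementary_Metric_Spaces"
begin

text \<open>
  The elements \<open>s l * adj (s (src l))\<close> form a Cuntz-Krieger family for the dual graph. Conversely, from
  a family \<open>t\<close> for the dual graph one recovers a family for \<open>G\<close> by putting
  \<open>q l = (\<Sum>e. t (l \<cdot> e))\<close>, where \<open>e\<close> ranges over the paths of degree \<open>p\<close> with range \<open>src l\<close>.
  The two constructions are mutually inverse, so universality yields mutually inverse homomorphisms
  and no gauge-invariant uniqueness theorem is needed.

  Two facts on C*-algebras enter: homomorphisms are continuous (to compare them on generators), and
  projections whose sum acts as a unit on each of them are mutually orthogonal (so that distinct paths
  of equal degree have orthogonal ranges). Both come from square roots, obtained by a contraction.
\<close>

section \<open>Square roots, automatic continuity and orthogonal projections\<close>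

text \<open>Lets a relation \<open>a * b = c\<close> be used inside right-associated words, where
  \<open>a * b\<close> no longer occurs as a subterm.\<close>

lemma mult_left_eq: "a * b = c \<Longrightarrow> a * (b * z) = c * (z::'a::semigroup_mult)"
  by (simp flip: mult.assoc)

lemma adj_zero [simp]: "adj (0::'a::cstar_algebra) = 0"
  using adj_add[of 0 0] by simp

lemma adj_scaleR: "adj (r *\<^sub>R x) = r *\<^sub>R adj (x::'a::cstar_algebra)"
  using adj_cscale[of "complex_of_real r" x] by (simp add: cscale_of_real)

lemma adj_minus: "adj (- x) = - adj (x::'a::cstar_algebra)"
  using adj_scaleR[of "-1" x] by simp

lemma adj_diff: "adj (x - y) = adj x - adj (y::'a::cstar_algebra)"
  using adj_add[of x "- y"] by (simp add: adj_minus)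

lemma adj_sum: "adj (sum f A) = (\<Sum>i\<in>A. adj (f i :: 'a::cstar_algebra))"
  by (induction A rule: infinite_finite_induct) (auto simp: adj_add)

lemma norm_adj [simp]: "norm (adj x) = norm (x::'a::cstar_algebra)"
proof -
  have le: "norm y \<le> norm (adj y)" for y :: 'a
  proof (cases "y = 0")
    case False
    have "norm y * norm y \<le> norm (adj y) * norm y"
      using norm_mult_ineq[of "adj y" y] by (simp add: cstar_identity)
    then show ?thesis using False by simp
  qed simp
  from le[of x] le[of "adj x"] show ?thesis by (simp add: adj_adj)
qed

lemma cstar_identity_zero: "adj x * x = 0 \<Longrightarrow> x = (0::'a::cstar_algebra)"
  using cstar_identity[of x] by simp

lemma norm_square_selfadjoint: "adj x = x \<Longrightarrow> norm (x * x) = norm x * norm (x::'a::cstar_algebra)"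
  using cstar_identity[of x] by simp

lemma continuous_on_adj [continuous_intros]:
  "continuous_on S f \<Longrightarrow> continuous_on S (\<lambda>x. adj (f x :: 'a::cstar_algebra))"
proof -
  have "bounded_linear (adj :: 'a \<Rightarrow> 'a)"
    by (rule bounded_linear_intro[where K = 1]) (simp_all add: adj_add adj_scaleR)
  then show "continuous_on S f \<Longrightarrow> continuous_on S (\<lambda>x. adj (f x))"
    by (rule bounded_linear.continuous_on)
qed

text \<open>The element \<open>y\<close> plays the role of \<open>1 - sqrt (1 - a)\<close>, which makes sense without a unit.\<close>
lemma sqrt_exists:
  fixes a :: "'a::cstar_algebra"
  assumes "adj a = a" "norm a < 1"
  obtains y where "adj y = y" "2 *\<^sub>R y - y * y = a"
    "\<And>z. z * a = a * z \<Longrightarrow> z * y = y * z" "\<And>z. z * a = a \<Longrightarrow> z * y = y"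
proof -
  \<comment> \<open>Commuting with everything that commutes with \<open>a\<close>, and being fixed
    by every left multiplication that fixes \<open>a\<close>, are closed conditions preserved by the
    iteration below. As part of the complete set \<open>S\<close> they pass to the fixed
    point.\<close>
  let ?C = "\<lambda>y. \<forall>z. (z * a = a * z \<longrightarrow> z * y = y * z) \<and> (z * a = a \<longrightarrow> z * y = y)"
  define S where "S = {y. norm y \<le> norm a \<and> adj y = y \<and> ?C y}"
  \<comment> \<open>Fixed points of \<open>f\<close> are the solutions of
    \<open>2 *\<^sub>R y - y * y = a\<close>. On the ball of radius \<open>norm a < 1\<close> it
    contracts with constant \<open>norm a\<close>.\<close>
  define f where "f y = (1/2) *\<^sub>R (a + y * y)" for y
  have S: "norm y \<le> norm a" "adj y = y" "z * a = a * z \<Longrightarrow> z * y = y * z" "z * a = a \<Longrightarrow> z * y = y"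
    if "y \<in> S" for y z using that unfolding S_def by blast+
  have SI: "y \<in> S" if "norm y \<le> norm a" "adj y = y" "\<And>z. z * a = a * z \<Longrightarrow> z * y = y * z"
    "\<And>z. z * a = a \<Longrightarrow> z * y = y" for y using that unfolding S_def by blast
  have "closed S" unfolding S_def
    by (intro closed_Collect_conj closed_Collect_all closed_Collect_imp closed_Collect_le closed_Collect_eq
        open_Collect_const continuous_intros continuous_on_id)
  then have comp: "complete S" by (simp add: complete_eq_closed)
  have ne: "S \<noteq> {}" using SI[of 0] by auto
  have norm2: "norm (y * y) \<le> norm a" if "norm y \<le> norm a" for y :: 'a
  proof -
    have "norm (y * y) \<le> norm y * norm y" by (rule norm_mult_ineq)
    also have "\<dots> \<le> norm a * 1" using that assms(2) by (intro mult_mono) auto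
    finally show ?thesis by simp
  qed
  have into: "f ` S \<subseteq> S"
  proof (rule image_subsetI)
    fix y assume y: "y \<in> S"
    have "norm (f y) \<le> norm a"
      using norm_triangle_ineq[of a "y * y"] norm2[of y] S(1)[OF y] by (simp add: f_def)
    moreover have "adj (f y) = f y"
      using S(2)[OF y] assms(1) by (simp add: f_def adj_scaleR adj_add adj_mult)
    moreover have "z * f y = f y * z" if "z * a = a * z" for z
    proof -
      have "z * y = y * z" using S(3)[OF y] that by blast
      then have "z * (y * y) = y * y * z" by (simp add: mult.assoc mult_left_eq[of z y])
      then show ?thesis using that by (simp add: f_def distrib_left distrib_right)
    qed
    moreover have "z * f y = f y" if "z * a = a" for z
    proof -
      have "z * y = y" using S(4)[OF y] that by blast
      then have "z * (y * y) = y * y" by (simp add: mult_left_eq)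
      then show ?thesis using that by (simp add: f_def distrib_left)
    qed
    ultimately show "f y \<in> S" by (rule SI)
  qed
  have lip: "dist (f x) (f y) \<le> norm a * dist x y" if "x \<in> S" "y \<in> S" for x y
  proof -
    \<comment> \<open>A splitting of \<open>x * x - y * y\<close> that is valid for noncommuting
      \<open>x\<close> and \<open>y\<close>.\<close>
    have "f x - f y = (1/2) *\<^sub>R (x * (x - y) + (x - y) * y)"
      by (simp add: f_def algebra_simps)
    then have "dist (f x) (f y) \<le> (norm (x * (x - y)) + norm ((x - y) * y)) / 2"
      using norm_triangle_ineq[of "x * (x - y)" "(x - y) * y"] by (simp add: dist_norm)
    also have "\<dots> \<le> (norm x * norm (x - y) + norm (x - y) * norm y) / 2"
      using norm_mult_ineq[of x "x - y"] norm_mult_ineq[of "x - y" y] by simp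
    also have "\<dots> \<le> (norm a * norm (x - y) + norm (x - y) * norm a) / 2"
      using S(1)[OF that(1)] S(1)[OF that(2)] by (intro divide_right_mono add_mono mult_mono) auto
    finally show ?thesis by (simp add: dist_norm)
  qed
  obtain y where y: "y \<in> S" "f y = y"
    using Banach_fix[OF comp ne norm_ge_zero assms(2) into] lip by blast
  have "2 *\<^sub>R f y = a + y * y" by (simp add: f_def)
  then have "2 *\<^sub>R y - y * y = a" using y(2) by simp
  then show thesis using that[of y] S[OF y(1)] by blast
qed

text \<open>\<open>e\<close> is the real part of \<open>x = e + cscale \<i> d\<close>, so
  \<open>norm e \<le> norm x\<close>; commutation makes \<open>adj x * x\<close> equal to
  \<open>d * d + e * e\<close>. This stands in for monotonicity of the norm on positive
  elements.\<close>

lemma norm_le_sum_squares: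
  fixes d e :: "'a::cstar_algebra"
  assumes "adj d = d" "adj e = e" "d * e = e * d"
  shows "norm e * norm e \<le> norm (d * d + e * e)"
proof -
  define x where "x = e + cscale \<i> d"
  have ii: "cscale (-1) z = - z" for z :: 'a using cscale_of_real[of "-1" z] by simp
  have adj_x: "adj x = e + cscale (- \<i>) d"
    using assms by (simp add: x_def adj_add adj_cscale)
  have [simp]: "cscale 0 z = 0" "cscale 1 z = z" for z :: 'a
    using cscale_of_real[of 0 z] cscale_of_real[of 1 z] by simp_all
  have cc: "cscale \<i> z + cscale (- \<i>) z = 0" for z :: 'a
    using cscale_add_left[of \<i> "- \<i>" z] by simp
  have "adj x * x = d * d + e * e + (cscale \<i> (e * d) + cscale (- \<i>) (d * e))"
    by (simp add: adj_x) (simp add: x_def distrib_left distrib_right mult_cscale_left mult_cscale_right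
        cscale_cscale cscale_add_right)
  then have "norm x * norm x = norm (d * d + e * e)"
    using assms(3) by (simp add: cc flip: cstar_identity)
  moreover have "2 *\<^sub>R e = x + adj x"
    using cc[of d] by (simp add: adj_x) (simp add: x_def scaleR_2 add_ac)
  then have "2 * norm e \<le> norm x + norm (adj x)"
    using norm_triangle_ineq[of x "adj x"] by (metis norm_scaleR abs_numeral)
  then have "norm e * norm e \<le> norm x * norm x"
    by (intro mult_mono) auto
  ultimately show ?thesis by simp
qed

section \<open>Contractivity and continuity of homomorphisms\<close>

lemma star_hom_zero: "star_hom f \<Longrightarrow> f 0 = 0"
  unfolding star_hom_def by (metis add_cancel_right_right)

lemma star_hom_scaleR: "star_hom f \<Longrightarrow> f (r *\<^sub>R x) = r *\<^sub>R f x"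
  unfolding star_hom_def by (metis cscale_of_real)

lemma star_hom_diff: "star_hom f \<Longrightarrow> f (x - y) = f x - f y"
  unfolding star_hom_def by (metis add_diff_cancel diff_add_cancel)

lemma star_hom_sum: "star_hom f \<Longrightarrow> f (sum g A) = (\<Sum>i\<in>A. f (g i))"
  by (induction A rule: infinite_finite_induct) (auto simp: star_hom_zero star_hom_def)

lemma star_hom_comp: "star_hom f \<Longrightarrow> star_hom g \<Longrightarrow> star_hom (\<lambda>x. f (g x))"
  by (simp add: star_hom_def)

text \<open>With \<open>k = f h\<close> and \<open>z = f y\<close> one has \<open>k\<^sup>2 + (1 - z)\<^sup>2 = 1\<close>, so that \<open>k\<close> is the real part of the
  unitary \<open>k + \<i> (1 - z)\<close>; lacking a unit, everything is multiplied by \<open>k\<close>.\<close>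
lemma star_hom_norm_selfadjoint:
  fixes f :: "'a::cstar_algebra \<Rightarrow> 'b::cstar_algebra"
  assumes f: "star_hom f" and h: "adj h = h" "norm h < 1"
  shows "norm (f h) \<le> 1"
proof -
  have "norm (h * h) < 1" 
    using h by (simp add: norm_square_selfadjoint mult_less_cancel_left_disj abs_square_less_1 flip: power2_eq_square)
  then obtain y where y: "adj y = y" "2 *\<^sub>R y - y * y = h * h" "h * y = y * h"
    using sqrt_exists[of "h * h"] h(1) by (metis adj_mult mult.assoc)
  let ?k = "f h" and ?z = "f y"
  have fm: "f (u * v) = f u * f v" for u v using f by (simp add: star_hom_def)
  have k: "adj ?k = ?k" and z: "adj ?z = ?z"
    using f h y by (metis star_hom_def)+
  have kz: "?k * ?z = ?z * ?k" by (metis fm y(3))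
  have sq: "2 *\<^sub>R ?z - ?z * ?z = ?k * ?k"
    using arg_cong[OF y(2), of f] by (simp add: star_hom_diff[OF f] star_hom_scaleR[OF f] fm)
  define e where "e = ?k * ?k"
  define d where "d = ?k - ?z * ?k"
  have "adj e = e" "adj d = d" 
    using k z kz by (simp_all add: e_def d_def adj_mult adj_diff)
  moreover have "d * e = e * d"
    by (simp add: d_def e_def left_diff_distrib right_diff_distrib mult.assoc kz mult_left_eq[OF kz])
  moreover have "d * d + e * e = ?k * ?k"
  proof -
    have "d * d = ?k * ?k - (2 *\<^sub>R ?z - ?z * ?z) * ?k * ?k"
      by (simp add: d_def left_diff_distrib right_diff_distrib mult.assoc kz mult_left_eq[OF kz] scaleR_2 distrib_right)
    then show ?thesis by (simp add: sq e_def mult.assoc)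
  qed
  \<comment> \<open>The sum of squares is \<open>?k * ?k\<close>, that is, \<open>e\<close> again;
    this makes the bound quadratic in \<open>norm e\<close> on one side and linear on the
    other.\<close>
  ultimately have "norm e * norm e \<le> norm e"
    using norm_le_sum_squares[of d e] by (simp add: e_def)
  then have "norm e \<le> 1" by (cases "norm e = 0") (auto simp: mult_le_cancel_right1)
  then have "norm ?k * norm ?k \<le> 1" using k by (simp add: e_def norm_square_selfadjoint)
  then show ?thesis by (metis abs_le_square_iff abs_norm_cancel abs_one one_power2 power2_eq_square)
qed

text \<open>For selfadjoint \<open>h\<close>, dividing by \<open>norm h + e\<close> with
  \<open>e > 0\<close> brings the norm below 1 and covers \<open>h = 0\<close> as well. The
  C*-identity for \<open>adj x * x\<close> reduces the general case to this one.\<close>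

lemma star_hom_contractive:
  fixes f :: "'a::cstar_algebra \<Rightarrow> 'b::cstar_algebra"
  assumes f: "star_hom f"
  shows "norm (f x) \<le> norm x"
proof -
  have sa: "norm (f h) \<le> norm h" if h: "adj h = h" for h
  proof (rule field_le_epsilon)
    fix e :: real assume e: "e > 0"
    define c where "c = norm h + e"
    have c: "c > 0" using e by (simp add: c_def add_nonneg_pos)
    have "norm (f ((1/c) *\<^sub>R h)) \<le> 1"
      using c e h by (intro star_hom_norm_selfadjoint[OF f]) (auto simp: adj_scaleR c_def)
    then have "norm (f h) \<le> c"
      using c by (simp add: star_hom_scaleR[OF f] field_simps)
    then show "norm (f h) \<le> norm h + e" by (simp add: c_def)
  qed
  have "norm (f x) * norm (f x) = norm (f (adj x * x))"
    using f by (simp add: star_hom_def cstar_identity)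
  also have "\<dots> \<le> norm x * norm x"
    using sa[of "adj x * x"] by (simp add: adj_mult adj_adj cstar_identity)
  finally show ?thesis by (metis abs_le_square_iff abs_norm_cancel power2_eq_square)
qed

lemma star_hom_continuous: "star_hom f \<Longrightarrow> continuous_on UNIV f"
  by (rule bounded_linear.continuous_on[OF _ continuous_on_id], rule bounded_linear_intro[where K = 1])
    (simp_all add: star_hom_contractive star_hom_scaleR, simp add: star_hom_def)

text \<open>The set where two continuous homomorphisms agree is a closed star-subalgebra, so it
  contains \<open>cstar_gen S\<close> once it contains \<open>S\<close>.\<close>

lemma star_hom_eq_on_gen:
  assumes "star_hom f" "star_hom g" "cstar_gen S = UNIV" "\<And>x. x \<in> S \<Longrightarrow> f x = g x"
  shows "f = g"
proof -
  have "closed {x. f x = g x}"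
    by (intro closed_Collect_eq star_hom_continuous assms)
  then have "cstar_gen S \<subseteq> {x. f x = g x}"
    unfolding cstar_gen_def using assms(1,2,4) by (intro Inter_lower) (auto simp: star_hom_def)
  then show ?thesis using assms(3) by auto
qed

text \<open>Antisymmetry of the order of the corner with unit \<open>P\<close>: both \<open>\<epsilon> P - h\<close> and \<open>\<epsilon> P + h\<close> are
  squares for every \<open>\<epsilon> > 0\<close>, and their sum has norm at most \<open>2 \<epsilon>\<close>.\<close>
lemma eq_zero_of_norm_le:
  fixes P h :: "'a::cstar_algebra"
  assumes P: "adj P = P" "P * P = P" and h: "adj h = h" "P * h = h"
    and c: "c > 0" "norm (c *\<^sub>R P + h) \<le> c" "norm (c *\<^sub>R P - h) \<le> c"
  shows "h = 0"
proof -
  have hP: "h * P = h" using h P by (metis adj_mult)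
  have nP: "norm P \<le> 1"
    using cstar_identity[of P] P by (cases "norm P = 0") auto
  have main: "norm h \<le> 3 * e" if e: "e > 0" for e
  proof -
    \<comment> \<open>Dividing by \<open>c + e\<close> instead of \<open>c\<close> makes both norms
      strictly less than 1, as \<open>sqrt_exists\<close> demands.\<close>
    define a where "a = (1 / (c + e)) *\<^sub>R (c *\<^sub>R P + h)"
    define b where "b = (1 / (c + e)) *\<^sub>R (c *\<^sub>R P - h)"
    have sab: "adj a = a" "adj b = b" using P h by (simp_all add: a_def b_def adj_scaleR adj_add adj_diff)
    have nab: "norm a < 1" "norm b < 1"
      unfolding a_def b_def norm_scaleR using c e by (simp_all add: divide_less_eq)
    have Pab: "P * a = a" "P * b = b" "a * b = b * a"
      using P h hP by (simp_all add: a_def b_def algebra_simps)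
    obtain y where y: "adj y = y" "2 *\<^sub>R y - y * y = a" "\<And>z. z * a = a * z \<Longrightarrow> z * y = y * z" "P * y = y"
      using sqrt_exists[OF sab(1) nab(1)] Pab(1) by metis
    obtain x where x: "adj x = x" "2 *\<^sub>R x - x * x = b" "\<And>z. z * b = b * z \<Longrightarrow> z * x = x * z" "P * x = x"
      using sqrt_exists[OF sab(2) nab(2)] Pab(2) by metis
    have yx: "x * y = y * x" using x(3)[of a] y(3)[of x] Pab(3) by simp
    have P': "y * P = y" "x * P = x" using x(1,4) y(1,4) P by (metis adj_mult)+
    \<comment> \<open>In the corner with unit \<open>P\<close>, the elements \<open>P - y\<close>
      and \<open>P - x\<close> are commuting selfadjoint square roots of \<open>P - a\<close> and
      \<open>P - b\<close>, so \<open>norm_le_sum_squares\<close> compares them.\<close>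
    have sq1: "(P - y) * (P - y) = P - a" 
      using y(4) P' P(2) by (simp add: algebra_simps scaleR_2 flip: y(2))
    have sq2: "(P - x) * (P - x) = P - b" 
      using x(4) P' P(2) by (simp add: algebra_simps scaleR_2 flip: x(2))
    have "norm (P - x) * norm (P - x) \<le> norm ((P - y) * (P - y) + (P - x) * (P - x))"
      using x(1,4) y(1,4) P P' yx by (intro norm_le_sum_squares) (simp_all add: adj_diff algebra_simps)
    moreover have "norm (P - x) * norm (P - x) = norm (P - b)"
      using norm_square_selfadjoint[of "P - x"] x(1) P(1) by (simp add: adj_diff sq2)
    ultimately have "norm (P - b) \<le> norm ((P - a) + (P - b))"
      by (simp only: sq1 sq2)
    then have "norm ((c + e) *\<^sub>R (P - b)) \<le> norm ((c + e) *\<^sub>R ((P - a) + (P - b)))"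
      unfolding norm_scaleR by (rule mult_left_mono) simp
    \<comment> \<open>Undoing the scaling turns \<open>P - b\<close> into
      \<open>e *\<^sub>R P + h\<close> and the sum of both squares into
      \<open>(2 * e) *\<^sub>R P\<close>, which leaves \<open>norm h \<le> 3 * e\<close>.\<close>
    moreover have ca: "(c + e) *\<^sub>R a = c *\<^sub>R P + h" and cb: "(c + e) *\<^sub>R b = c *\<^sub>R P - h"
      unfolding a_def b_def scaleR_scaleR using c e by simp_all
    have "(c + e) *\<^sub>R (P - b) = e *\<^sub>R P + h"
      unfolding scaleR_diff_right cb by (simp add: scaleR_add_left)
    moreover have "(c + e) *\<^sub>R ((P - a) + (P - b)) = (2 * e) *\<^sub>R P"
      unfolding scaleR_diff_right scaleR_add_right ca cb
      by (simp add: scaleR_add_left scaleR_2 flip: scaleR_scaleR)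
    ultimately have "norm (e *\<^sub>R P + h) \<le> norm ((2 * e) *\<^sub>R P)" by simp
    also have "\<dots> \<le> 2 * e" using nP e by simp
    finally have "norm (e *\<^sub>R P + h) \<le> 2 * e" .
    moreover have "norm (e *\<^sub>R P) \<le> e" using nP e by simp
    ultimately show "norm h \<le> 3 * e"
      using norm_triangle_ineq4[of "e *\<^sub>R P + h" "e *\<^sub>R P"] by simp
  qed
  have "norm h \<le> 0"
  proof (rule field_le_epsilon)
    fix e :: real assume "e > 0"
    then show "norm h \<le> 0 + e" using main[of "e/3"] by simp
  qed
  then show ?thesis by simp
qed

text \<open>Compress to the corner of \<open>P j\<close>. The elements \<open>b l\<close> with
  \<open>l \<noteq> j\<close> sum to zero and behave like positive contractions, which forces
  \<open>b i\<close> to vanish; and \<open>b i\<close> is \<open>adj x * x\<close> for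
  \<open>x = P i * P j\<close>.\<close>

lemma projections_orthogonal:
  fixes P :: "'i \<Rightarrow> 'a::cstar_algebra"
  assumes fin: "finite I" and P: "\<And>i. i \<in> I \<Longrightarrow> adj (P i) = P i" "\<And>i. i \<in> I \<Longrightarrow> P i * P i = P i"
    and sub: "\<And>i. i \<in> I \<Longrightarrow> sum P I * P i = P i"
    and ij: "i \<in> I" "j \<in> I" "i \<noteq> j"
  shows "P i * P j = 0"
proof -
  define b where "b l = P j * P l * P j" for l
  define J where "J = I - {j}"
  have J: "finite J" "i \<in> J" using fin ij by (auto simp: J_def)
  have norm_P: "norm (P j) \<le> 1"
    using cstar_identity[of "P j"] P ij by (cases "norm (P j) = 0") auto
  have norm_b: "norm (P j - b l) \<le> 1" if "l \<in> J" for l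
  proof -
    have l: "adj (P l) = P l" "P l * P l = P l" using P that by (auto simp: J_def)
    \<comment> \<open>\<open>x\<close> plays the role of \<open>(1 - P l) * P j\<close>. Both
      \<open>adj x * x\<close> and \<open>P j * x\<close> equal \<open>P j - b l\<close>, which
      bounds first \<open>norm x\<close> and then \<open>P j - b l\<close>.\<close>
    define x where "x = P j - P l * P j"
    have eq: "adj x * x = P j - b l" "P j * x = P j - b l"
      using l P ij by (simp_all add: x_def b_def adj_diff adj_mult left_diff_distrib right_diff_distrib mult.assoc
          mult_left_eq[OF l(2)] mult_left_eq[OF P(2)[OF ij(2)]])
    then have "norm x * norm x \<le> norm (P j) * norm x"
      by (metis cstar_identity norm_mult_ineq)
    then have "norm x \<le> norm (P j)" by (cases "norm x = 0") auto
    then have "norm x \<le> 1" using norm_P by simp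
    moreover have "norm (P j * x) \<le> norm (P j) * norm x" by (rule norm_mult_ineq)
    ultimately show ?thesis using eq norm_P
      by (metis mult_le_one norm_ge_zero order_trans)
  qed
  have sum_b: "sum b J = 0"
  proof -
    have "sum P I = P j + sum P J" using fin ij by (simp add: J_def sum.remove[of I j])
    then have "P j * (sum P I * P j) = P j + sum b J"
      using P ij by (simp add: distrib_left distrib_right sum_distrib_left sum_distrib_right b_def mult.assoc)
    then show ?thesis using sub P ij by simp
  qed
  define M where "M = real (card J)"
  have M: "M > 0" using J by (auto simp: M_def card_gt_0_iff)
  \<comment> \<open>\<open>x\<close> and \<open>y\<close> exhibit
    \<open>M *\<^sub>R P j + b i\<close> and \<open>M *\<^sub>R P j - b i\<close> as sums of
    \<open>card J\<close> terms of norm at most 1. For \<open>x\<close> this works because the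
    \<open>- b l\<close> with \<open>l \<noteq> i\<close> add up to \<open>b i\<close>.\<close>
  define x where "x l = (if l = i then P j else P j - b l)" for l
  define y where "y l = (if l = i then P j - b l else P j)" for l
  have "sum x J = (\<Sum>l\<in>J. P j - b l) + b i"
    using J by (simp add: x_def sum.remove[of J i])
  then have 1: "M *\<^sub>R P j + b i = sum x J"
    using sum_b by (simp add: sum_subtractf M_def sum_constant_scaleR)
  have "sum y J = (\<Sum>l\<in>J. P j) - b i"
    using J by (simp add: y_def sum.remove[of J i])
  then have 2: "M *\<^sub>R P j - b i = sum y J"
    by (simp add: M_def sum_constant_scaleR)
  have "norm (sum x J) \<le> of_nat (card J) * 1"
    by (rule sum_norm_bound) (auto simp: x_def norm_P norm_b)
  moreover have "norm (sum y J) \<le> of_nat (card J) * 1"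
    by (rule sum_norm_bound) (auto simp: y_def norm_P norm_b)
  ultimately have "norm (M *\<^sub>R P j + b i) \<le> M" "norm (M *\<^sub>R P j - b i) \<le> M"
    unfolding 1 2 by (simp_all add: M_def)
  moreover have "adj (b i) = b i" "P j * b i = b i"
    using P ij by (simp_all add: b_def adj_mult mult.assoc mult_left_eq[OF P(2)[OF ij(2)]])
  ultimately have "b i = 0"
    using eq_zero_of_norm_le[of "P j" "b i" M] P ij M by blast
  moreover have "adj (P i * P j) * (P i * P j) = b i"
    using P ij by (simp add: b_def adj_mult mult.assoc mult_left_eq[OF P(2)[OF ij(1)]])
  ultimately show ?thesis by (metis cstar_identity_zero)
qed

section \<open>Dual graphs\<close>

locale kgraph =
  fixes k :: nat and G :: "'p kgraph"
  assumes is_kgraph: "is_kgraph k G"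
begin

abbreviation comp (infixl "\<cdot>" 70) where "l \<cdot> m \<equiv> cmp G l m"

lemma deg_nk: "l \<in> paths G \<Longrightarrow> deg G l \<in> nk k"
  and rng_verts: "l \<in> paths G \<Longrightarrow> rng G l \<in> verts G"
  and src_verts: "l \<in> paths G \<Longrightarrow> src G l \<in> verts G"
  and rng_vert: "v \<in> verts G \<Longrightarrow> rng G v = v"
  and src_vert: "v \<in> verts G \<Longrightarrow> src G v = v"
  and cmp_rng: "l \<in> paths G \<Longrightarrow> rng G l \<cdot> l = l"
  and cmp_src: "l \<in> paths G \<Longrightarrow> l \<cdot> src G l = l"
  using is_kgraph unfolding is_kgraph_def by blast+

lemma
  assumes "l \<in> paths G" "m \<in> paths G" "src G l = rng G m"
  shows cmp_paths: "l \<cdot> m \<in> paths G"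
    and rng_cmp: "rng G (l \<cdot> m) = rng G l"
    and src_cmp: "src G (l \<cdot> m) = src G m"
    and deg_cmp: "deg G (l \<cdot> m) = (\<lambda>i. deg G l i + deg G m i)"
  using is_kgraph assms unfolding is_kgraph_def by blast+

lemma cmp_assoc:
  assumes "l \<in> paths G" "m \<in> paths G" "n \<in> paths G" "src G l = rng G m" "src G m = rng G n"
  shows "l \<cdot> m \<cdot> n = l \<cdot> (m \<cdot> n)"
  using is_kgraph assms unfolding is_kgraph_def by blast

lemma vert_path: "v \<in> verts G \<Longrightarrow> v \<in> paths G"
  and deg_vert: "v \<in> verts G \<Longrightarrow> deg G v = (\<lambda>_. 0)"
  by (auto simp: verts_def)

lemma factorisation_exists:
  assumes "l \<in> paths G" "deg G l = (\<lambda>i. a i + b i)"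
  obtains mu nu where "mu \<in> paths G" "nu \<in> paths G" "deg G mu = a" "deg G nu = b"
    "src G mu = rng G nu" "l = mu \<cdot> nu"
  using is_kgraph assms unfolding is_kgraph_def by blast

text \<open>Only the first factors are assumed to have equal degree; for the second factors this
  follows by cancelling in the degree of the common product.\<close>

lemma factorisation_unique:
  assumes "mu \<in> paths G" "nu \<in> paths G" "src G mu = rng G nu"
    and "mu' \<in> paths G" "nu' \<in> paths G" "src G mu' = rng G nu'"
    and eq: "mu \<cdot> nu = mu' \<cdot> nu'" and deg: "deg G mu = deg G mu'"
  shows "mu = mu' \<and> nu = nu'"
proof -
  have "(\<lambda>i. deg G mu i + deg G nu i) = (\<lambda>i. deg G mu' i + deg G nu' i)"
    using deg_cmp[OF assms(1-3)] deg_cmp[OF assms(4-6)] eq by simp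
  then have deg': "deg G nu = deg G nu'" using deg by (simp add: fun_eq_iff)
  have "\<forall>l\<in>paths G. \<forall>a b. deg G l = (\<lambda>i. a i + b i) \<longrightarrow>
        (\<exists>!q. case q of (mu, nu) \<Rightarrow> mu \<in> paths G \<and> nu \<in> paths G \<and> deg G mu = a \<and> deg G nu = b \<and>
                src G mu = rng G nu \<and> l = cmp G mu nu)"
    using is_kgraph unfolding is_kgraph_def by blast
  then have "\<exists>!q. case q of (m, n) \<Rightarrow> m \<in> paths G \<and> n \<in> paths G \<and> deg G m = deg G mu \<and>
      deg G n = deg G nu \<and> src G m = rng G n \<and> mu \<cdot> nu = m \<cdot> n"
    using cmp_paths[OF assms(1-3)] deg_cmp[OF assms(1-3)] by blast
  then have "(mu, nu) = (mu', nu')"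
    by (rule ex1E) (use assms deg' in \<open>metis (mono_tags, lifting) case_prod_conv\<close>)
  then show ?thesis by simp
qed

text \<open>Evaluates the \<open>THE\<close> in \<open>seg\<close> from a known factorisation.
  Uniqueness uses the factorisation property twice: to split \<open>l\<close> at \<open>b\<close>,
  then the initial part at \<open>a\<close>.\<close>

lemma seg_eq:
  assumes "al \<in> paths G" "nu \<in> paths G" "be \<in> paths G" "src G al = rng G nu" "src G nu = rng G be"
    and l: "l = al \<cdot> nu \<cdot> be" and a: "a = deg G al" and b: "b = (\<lambda>i. deg G al i + deg G nu i)"
  shows "seg G l a b = nu"
  unfolding seg_def
proof (rule the_equality)
  have comp: "al \<cdot> nu \<in> paths G" "src G (al \<cdot> nu) = rng G be" "deg G (al \<cdot> nu) = b"
    using assms by (simp_all add: cmp_paths src_cmp deg_cmp)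
  then have "deg G l = (\<lambda>i. b i + deg G be i)" using assms by (simp add: deg_cmp)
  then have deg_l: "(\<lambda>i. deg G l i - b i) = deg G be" by simp
  have deg_nu: "(\<lambda>i. b i - a i) = deg G nu" using a b by simp
  show "\<exists>al be. al \<in> paths G \<and> nu \<in> paths G \<and> be \<in> paths G \<and>
      deg G al = a \<and> deg G nu = (\<lambda>i. b i - a i) \<and> deg G be = (\<lambda>i. deg G l i - b i) \<and>
      src G al = rng G nu \<and> src G nu = rng G be \<and> l = al \<cdot> nu \<cdot> be"
    unfolding deg_l deg_nu using assms(1-6) a by blast
  fix nu'
  assume "\<exists>al be. al \<in> paths G \<and> nu' \<in> paths G \<and> be \<in> paths G \<and>
      deg G al = a \<and> deg G nu' = (\<lambda>i. b i - a i) \<and> deg G be = (\<lambda>i. deg G l i - b i) \<and>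
      src G al = rng G nu' \<and> src G nu' = rng G be \<and> l = al \<cdot> nu' \<cdot> be"
  then obtain al' be' where *: "al' \<in> paths G" "nu' \<in> paths G" "be' \<in> paths G"
      "deg G al' = a" "deg G nu' = deg G nu" "src G al' = rng G nu'" "src G nu' = rng G be'"
      "l = al' \<cdot> nu' \<cdot> be'"
    unfolding deg_l deg_nu by blast
  then have comp': "al' \<cdot> nu' \<in> paths G" "src G (al' \<cdot> nu') = rng G be'" "deg G (al' \<cdot> nu') = b"
    using a b by (simp_all add: cmp_paths src_cmp deg_cmp)
  have "al' \<cdot> nu' = al \<cdot> nu"
    using factorisation_unique[of "al' \<cdot> nu'" be' "al \<cdot> nu" be] comp comp' * assms by metis
  then show "nu' = nu"
    using factorisation_unique[of al' nu' al nu] * assms by metis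
qed

text \<open>Initial and final segments are middle segments with a vertex as one outer
  factor.\<close>

lemma
  assumes "mu \<in> paths G" "nu \<in> paths G" "src G mu = rng G nu"
  shows seg_prefix: "seg G (mu \<cdot> nu) (\<lambda>_. 0) (deg G mu) = mu"
    and seg_suffix: "seg G (mu \<cdot> nu) (deg G mu) (deg G (mu \<cdot> nu)) = nu"
proof -
  show "seg G (mu \<cdot> nu) (\<lambda>_. 0) (deg G mu) = mu"
    using assms rng_verts[of mu]
    by (intro seg_eq[of "rng G mu" mu nu]) (auto simp: vert_path src_vert cmp_rng deg_vert)
  show "seg G (mu \<cdot> nu) (deg G mu) (deg G (mu \<cdot> nu)) = nu"
    using assms src_verts[of nu] cmp_src[OF cmp_paths[OF assms]]
    by (intro seg_eq[of mu nu "src G nu"]) (auto simp: vert_path rng_vert deg_cmp src_cmp)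
qed

end

section \<open>Paths, vertices and composition of the dual graph\<close>

locale dual_kgraph = kgraph k G for k :: nat and G :: "'p kgraph" +
  fixes p :: "nat \<Rightarrow> nat"
  assumes p_nk: "p \<in> nk k"
begin

abbreviation D where "D \<equiv> dual G p"

lemma dual_paths_iff: "l \<in> paths D \<longleftrightarrow> l \<in> paths G \<and> (\<forall>i. p i \<le> deg G l i)"
  and dual_deg: "deg D l = (\<lambda>i. deg G l i - p i)"
  by (simp_all add: dual_def)

text \<open>Subtraction of naturals truncates, so degree zero in \<open>D\<close> only says that
  \<open>deg G v\<close> is at most \<open>p\<close>; membership in \<open>paths D\<close> gives the
  converse inequality.\<close>

lemma dual_verts_iff: "v \<in> verts D \<longleftrightarrow> v \<in> paths G \<and> deg G v = p"
  unfolding verts_def by (auto simp: dual_paths_iff dual_deg fun_eq_iff) (metis le_antisym)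

lemma dual_vert_path: "v \<in> verts D \<Longrightarrow> v \<in> paths D"
  by (simp add: verts_def)

lemma dual_path: "l \<in> paths D \<Longrightarrow> l \<in> paths G"
  by (simp add: dual_paths_iff)

lemma dual_deg_nk: "l \<in> paths D \<Longrightarrow> deg D l \<in> nk k"
  using deg_nk[of l] by (auto simp: dual_paths_iff dual_deg nk_def)

lemma
  assumes "e \<in> verts D" "m \<in> paths G" "src G e = rng G m"
  shows dual_prefix_path: "e \<cdot> m \<in> paths D"
    and dual_rng: "rng D (e \<cdot> m) = e"
    and dual_deg_prefix: "deg D (e \<cdot> m) = deg G m"
    and dual_drop: "seg G (e \<cdot> m) p (deg G (e \<cdot> m)) = m"
  using assms seg_prefix[of e m] seg_suffix[of e m]
  by (auto simp: dual_verts_iff dual_paths_iff dual_deg cmp_paths deg_cmp) (simp add: dual_def)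

lemma
  assumes "m \<in> paths G" "e \<in> verts D" "src G m = rng G e"
  shows dual_suffix_path: "m \<cdot> e \<in> paths D"
    and dual_src: "src D (m \<cdot> e) = e"
    and dual_deg_suffix: "deg D (m \<cdot> e) = deg G m"
  using assms seg_suffix[of m e]
  by (auto simp: dual_verts_iff dual_paths_iff dual_deg cmp_paths deg_cmp) (simp add: dual_def deg_cmp)

text \<open>The factor \<open>e\<close> cut off here is the dual range of \<open>l\<close>, and the
  one in \<open>dual_suffix_cases\<close> is the dual source. These two splittings turn segments
  into plain compositions.\<close>

lemma dual_prefix_cases:
  assumes "l \<in> paths D"
  obtains e m where "e \<in> verts D" "m \<in> paths G" "src G e = rng G m" "l = e \<cdot> m"
proof -
  have "deg G l = (\<lambda>i. p i + deg D l i)" using assms by (auto simp: dual_paths_iff dual_deg)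
  then show thesis
    using factorisation_exists[of l p "deg D l"] assms that by (metis dual_path dual_verts_iff)
qed

lemma dual_suffix_cases:
  assumes "l \<in> paths D"
  obtains m e where "m \<in> paths G" "e \<in> verts D" "src G m = rng G e" "l = m \<cdot> e"
proof -
  have "deg G l = (\<lambda>i. deg D l i + p i)" using assms by (auto simp: dual_paths_iff dual_deg)
  then show thesis
    using factorisation_exists[of l "deg D l" p] assms that by (metis dual_path dual_verts_iff)
qed

lemma dual_rng_verts: "l \<in> paths D \<Longrightarrow> rng D l \<in> verts D"
  by (metis dual_prefix_cases dual_rng)

lemma dual_src_verts: "l \<in> paths D \<Longrightarrow> src D l \<in> verts D"
  by (metis dual_suffix_cases dual_src)

lemma rng_dual_rng: "l \<in> paths D \<Longrightarrow> rng G (rng D l) = rng G l"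
  by (metis dual_prefix_cases dual_rng rng_cmp dual_vert_path dual_path)

lemma src_dual_src: "l \<in> paths D \<Longrightarrow> src G (src D l) = src G l"
  by (metis dual_suffix_cases dual_src src_cmp dual_vert_path dual_path)

lemma dual_src_vert: "e \<in> verts D \<Longrightarrow> src D e = e"
  using dual_src[of "rng G e" e]
  by (simp add: dual_verts_iff cmp_rng vert_path rng_verts src_vert)

text \<open>The left factor ends in \<open>rng D l\<close>, with which \<open>l\<close> begins. Dual
  composition counts this overlap of degree \<open>p\<close> once, so it becomes composition in
  \<open>G\<close>.\<close>

lemma dual_cmp:
  assumes "m \<in> paths G" "l \<in> paths D" "src G m = rng G l"
  shows "cmp D (m \<cdot> rng D l) l = m \<cdot> l"
proof -
  obtain e n where *: "e \<in> verts D" "n \<in> paths G" "src G e = rng G n" "l = e \<cdot> n"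
    using assms(2) by (rule dual_prefix_cases)
  have "cmp D (m \<cdot> e) (e \<cdot> n) = m \<cdot> e \<cdot> n"
    using dual_drop[OF *(1-3)] by (simp add: dual_def)
  also have "\<dots> = m \<cdot> (e \<cdot> n)"
    using assms * by (intro cmp_assoc) (auto simp: dual_verts_iff rng_cmp)
  finally show ?thesis using * by (simp add: dual_rng)
qed

lemma dual_cmp_rng: "l \<in> paths D \<Longrightarrow> cmp D (rng D l) l = l"
  using dual_cmp[of "rng G l" l] dual_rng_verts[of l]
  by (simp add: dual_path vert_path rng_verts src_vert cmp_rng dual_verts_iff rng_dual_rng[symmetric])
    (simp add: rng_dual_rng dual_path cmp_rng)

end

section \<open>Cuntz-Krieger families\<close>

lemma
  assumes "CK_family k G t"
  shows CK_partial_isometry: "l \<in> paths G \<Longrightarrow> t l * adj (t l) * t l = t l"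
    and CK_vert_adj: "v \<in> verts G \<Longrightarrow> adj (t v) = t v"
    and CK_vert_orthogonal: "v \<in> verts G \<Longrightarrow> w \<in> verts G \<Longrightarrow> v \<noteq> w \<Longrightarrow> t v * t w = 0"
    and CK_cmp: "l \<in> paths G \<Longrightarrow> m \<in> paths G \<Longrightarrow> src G l = rng G m \<Longrightarrow> t (cmp G l m) = t l * t m"
    and CK_src: "l \<in> paths G \<Longrightarrow> adj (t l) * t l = t (src G l)"
    and CK_sum: "v \<in> verts G \<Longrightarrow> n \<in> nk k \<Longrightarrow>
      t v = (\<Sum>l\<in>{l \<in> paths G. deg G l = n \<and> rng G l = v}. t l * adj (t l))"
  using assms unfolding CK_family_def by simp_all

lemma CK_src_mult: "CK_family k G t \<Longrightarrow> l \<in> paths G \<Longrightarrow> t l * t (src G l) = t l"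
  using CK_partial_isometry[of k G t l] CK_src[of k G t l] by (simp add: mult.assoc)

lemma CK_rng:
  assumes "CK_family k G t" "l \<in> paths G" "rng G l \<in> verts G" "src G (rng G l) = rng G l"
    "cmp G (rng G l) l = l"
  shows "t (rng G l) * t l = t l"
  using CK_cmp[OF assms(1), of "rng G l" l] assms by (simp add: verts_def)

text \<open>The graph laws appear as hypotheses so that the lemma serves both \<open>G\<close> and
  \<open>D\<close>. Paths with different ranges are separated by their vertex projections. For a
  common range, the range projections of this degree sum to the vertex projection, a unit for each
  of them, and \<open>projections_orthogonal\<close> applies.\<close>

lemma CK_orthogonal:
  fixes t :: "'p \<Rightarrow> 'a::cstar_algebra"
  assumes ck: "CK_family k H t"
    and H: "\<And>l. l \<in> paths H \<Longrightarrow> rng H l \<in> verts H" "\<And>v. v \<in> verts H \<Longrightarrow> src H v = v"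
      "\<And>l. l \<in> paths H \<Longrightarrow> cmp H (rng H l) l = l" "\<And>l. l \<in> paths H \<Longrightarrow> deg H l \<in> nk k"
    and l: "l \<in> paths H" and m: "m \<in> paths H" and deg: "deg H l = deg H m" and ne: "l \<noteq> m"
  shows "adj (t l) * t m = 0"
proof -
  have rng: "t (rng H l) * t l = t l" if "l \<in> paths H" for l
    by (rule CK_rng[OF ck that H(1)[OF that] H(2)[OF H(1)[OF that]] H(3)[OF that]])
  note tl = CK_partial_isometry[OF ck]
  have pl: "adj (t l) = adj (t l) * (t l * adj (t l))" if "l \<in> paths H" for l
    using arg_cong[OF tl[OF that], of adj] by (simp add: adj_mult adj_adj mult.assoc)
  show ?thesis
  proof (cases "rng H l = rng H m")
    case False
    have "adj (t l) * t m = adj (t (rng H l) * t l) * (t (rng H m) * t m)"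
      using rng l m by simp
    also have "\<dots> = adj (t l) * (t (rng H l) * t (rng H m)) * t m"
      using CK_vert_adj[OF ck H(1)[OF l]] by (simp add: adj_mult mult.assoc)
    also have "t (rng H l) * t (rng H m) = 0"
      using CK_vert_orthogonal[OF ck] H(1) l m False by blast
    finally show ?thesis by simp
  next
    case True
    define I where "I = {l' \<in> paths H. deg H l' = deg H l \<and> rng H l' = rng H l}"
    define P where "P l' = t l' * adj (t l')" for l'
    have sum: "t (rng H l) = sum P I"
      unfolding I_def P_def by (rule CK_sum[OF ck H(1)[OF l] H(4)[OF l]])
    have PP: "P x * P x = P x" if "x \<in> I" for x
    proof -
      have "t x * (adj (t x) * t x) = t x" using tl[of x] that by (simp add: I_def mult.assoc)
      then show ?thesis using mult_left_eq[of "t x" "adj (t x) * t x"] by (simp add: P_def mult.assoc)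
    qed
    have "P l * P m = 0"
    proof (cases "finite I")
      case True
      show ?thesis
      proof (rule projections_orthogonal[of I])
        show "adj (P i) = P i" for i by (simp add: P_def adj_mult adj_adj)
        show "sum P I * P i = P i" if "i \<in> I" for i
        proof -
          have "t (rng H l) * t i = t i" using rng[of i] that by (simp add: I_def)
          then show ?thesis unfolding sum[symmetric] by (simp add: P_def flip: mult.assoc)
        qed
      qed (use True PP l m deg ne \<open>rng H l = rng H m\<close> in \<open>auto simp: I_def\<close>)
    next
      \<comment> \<open>A sum over an infinite set is 0 by convention, so the vertex projection
        vanishes, and \<open>t l\<close> with it.\<close>
      case False
      then have "t (rng H l) = 0" using sum by simp
      then have "t l = 0" using rng[OF l] by simp
      then show ?thesis by (simp add: P_def)
    qed
    moreover have "adj (t l) * P l = adj (t l)" "P m * t m = t m"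
      using pl[OF l] tl[OF m] by (simp_all add: P_def)
    then have "adj (t l) * t m = adj (t l) * (P l * P m) * t m"
      by (metis mult.assoc)
    ultimately show ?thesis by simp
  qed
qed

context kgraph
begin

lemma CK_paths_orthogonal:
  assumes "CK_family k G s" "l \<in> paths G" "m \<in> paths G" "deg G l = deg G m" "l \<noteq> m"
  shows "adj (s l) * s m = 0"
  using assms by (intro CK_orthogonal[of k G]) (auto intro: rng_verts src_vert cmp_rng deg_nk)

end

section \<open>From families for \<open>G\<close> to families for the dual graph\<close>

context dual_kgraph
begin

lemma CK_dual_paths_orthogonal:
  assumes "CK_family k D t" "l \<in> paths D" "m \<in> paths D" "deg D l = deg D m" "l \<noteq> m"
  shows "adj (t l) * t m = 0"
  using assms by (intro CK_orthogonal[of k D])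
    (auto intro: dual_rng_verts dual_src_vert dual_cmp_rng dual_deg_nk)

lemma CK_dual_rng_mult:
  assumes "CK_family k D t" "l \<in> paths D"
  shows "t (rng D l) * t l = t l"
  using assms by (intro CK_rng) (auto intro: dual_rng_verts dual_src_vert dual_cmp_rng)

text \<open>For \<open>l = m \<cdot> e\<close> with \<open>e\<close> of degree \<open>p\<close>, the
  element is \<open>s m\<close> cut down by the range projection of \<open>s e\<close>. It keeps the
  range projection of \<open>s l\<close>, and its initial projection is
  \<open>s e * adj (s e)\<close>, the element attached to the dual source \<open>e\<close>.\<close>

lemma CK_family_restrict:
  fixes s :: "'p \<Rightarrow> 'a::cstar_algebra"
  assumes ck: "CK_family k G s"
  shows "CK_family k D (\<lambda>l. s l * adj (s (src D l)))"
proof -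
  let ?r = "\<lambda>l. s l * adj (s (src D l))"
  note pi = CK_partial_isometry[OF ck]
  have pi': "s l * (adj (s l) * s l) = s l" if "l \<in> paths G" for l
    using pi[OF that] by (simp add: mult.assoc)
  have r_eq: "?r l = s m * (s e * adj (s e))"
    if "m \<in> paths G" "e \<in> verts D" "src G m = rng G e" "l = m \<cdot> e" for l m e
    using that dual_src[OF that(1-3)] CK_cmp[OF ck that(1) _ that(3)]
    by (simp add: dual_verts_iff mult.assoc)
  have r_vert: "?r e = s e * adj (s e)" if "e \<in> verts D" for e
    using that by (simp add: dual_src_vert)
  have r_src: "adj (?r l) * ?r l = ?r (src D l)" if l: "l \<in> paths D" for l
  proof -
    let ?e = "src D l"
    have e: "?e \<in> verts D" "?e \<in> paths G" using dual_src_verts[OF l] by (auto simp: dual_verts_iff)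
    have "adj (?r l) * ?r l = s ?e * (adj (s l) * s l) * adj (s ?e)"
      by (simp add: adj_mult adj_adj mult.assoc)
    also have "adj (s l) * s l = adj (s ?e) * s ?e"
      using CK_src[OF ck dual_path[OF l]] CK_src[OF ck e(2)] src_dual_src[OF l] by simp
    also have "s ?e * (adj (s ?e) * s ?e) * adj (s ?e) = s ?e * adj (s ?e)"
      using pi'[OF e(2)] by simp
    finally show ?thesis using r_vert[OF e(1)] by simp
  qed
  have r_range: "?r l * adj (?r l) = s l * adj (s l)" if l: "l \<in> paths D" for l
  proof -
    have e: "src D l \<in> paths G" using dual_src_verts[OF l] by (auto simp: dual_verts_iff)
    have "?r l * adj (?r l) = s l * (adj (s (src D l)) * s (src D l)) * adj (s l)"
      by (simp add: adj_mult adj_adj mult.assoc)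
    also have "adj (s (src D l)) * s (src D l) = adj (s l) * s l"
      using CK_src[OF ck dual_path[OF l]] CK_src[OF ck e] src_dual_src[OF l] by simp
    also have "s l * (adj (s l) * s l) * adj (s l) = s l * adj (s l)"
      using pi'[OF dual_path[OF l]] by simp
    finally show ?thesis .
  qed
  show ?thesis
    unfolding CK_family_def
  proof (intro conjI ballI impI)
    fix l assume l: "l \<in> paths D"
    show "adj (?r l) * ?r l = ?r (src D l)" by (rule r_src[OF l])
    show "?r l * adj (?r l) * ?r l = ?r l"
      unfolding r_range[OF l] by (simp add: pi[OF dual_path[OF l]] flip: mult.assoc)
  next
    fix v assume v: "v \<in> verts D"
    then have vG: "v \<in> paths G" by (simp add: dual_verts_iff)
    show "adj (?r v) = ?r v" unfolding r_vert[OF v] by (simp add: adj_mult adj_adj)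
    show "?r v * ?r v = ?r v"
      unfolding r_vert[OF v] by (simp add: pi[OF vG] flip: mult.assoc)
    fix w assume w: "w \<in> verts D" and "v \<noteq> w"
    then have "adj (s v) * s w = 0"
      using v by (intro CK_paths_orthogonal[OF ck]) (auto simp: dual_verts_iff)
    then show "?r v * ?r w = 0"
      unfolding r_vert[OF v] r_vert[OF w] by (simp add: mult.assoc mult_left_eq[of "adj (s v)" "s w" 0])
  next
    fix l m assume l: "l \<in> paths D" and m: "m \<in> paths D" and lm: "src D l = rng D m"
    \<comment> \<open>The shared dual vertex \<open>e\<close> ends \<open>l\<close> and begins
      \<open>m\<close>, so the dual product is \<open>n \<cdot> m\<close>. A second splitting of
      \<open>m\<close> exhibits its dual source \<open>f\<close>, which is also that of the
      product.\<close>
    obtain n e where n: "n \<in> paths G" "e \<in> verts D" "src G n = rng G e" "l = n \<cdot> e"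
      using l by (rule dual_suffix_cases)
    obtain e' b where b: "e' \<in> verts D" "b \<in> paths G" "src G e' = rng G b" "m = e' \<cdot> b"
      using m by (rule dual_prefix_cases)
    have ee: "e' = e" using lm n b by (simp add: dual_src dual_rng)
    have eG: "e \<in> paths G" using n by (simp add: dual_verts_iff)
    have nm: "src G n = rng G m" using n b eG by (simp add: ee rng_cmp)
    have eq: "cmp D l m = n \<cdot> m"
      using dual_cmp[OF n(1) m nm] dual_rng[OF b(1-3)] n b by (simp add: ee)
    obtain c f where c: "c \<in> paths G" "f \<in> verts D" "src G c = rng G f" "m = c \<cdot> f"
      using m by (rule dual_suffix_cases)
    have fG: "f \<in> paths G" using c by (simp add: dual_verts_iff)
    have "n \<cdot> m = n \<cdot> c \<cdot> f" using n c nm fG by (simp add: cmp_assoc rng_cmp)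
    then have src: "src D (n \<cdot> m) = f" "src D m = f"
      using dual_src[of "n \<cdot> c" f] dual_src[of c f] n c nm fG by (auto simp: cmp_paths src_cmp rng_cmp)
    have "?r l * ?r m = s n * (s e * adj (s e) * s m) * adj (s f)"
      unfolding r_eq[OF n] src by (simp add: mult.assoc)
    \<comment> \<open>The path \<open>m\<close> begins with \<open>e\<close>, so the range
      projection of \<open>s e\<close> fixes \<open>s m\<close>.\<close>
    also have "s e * adj (s e) * s m = s m"
      using CK_cmp[OF ck eG b(2)] b pi[OF eG] by (simp add: ee flip: mult.assoc)
    also have "s n * s m = s (n \<cdot> m)" using CK_cmp[OF ck n(1) dual_path[OF m] nm] by simp
    finally show "?r (cmp D l m) = ?r l * ?r m" by (simp add: eq src)
  next
    fix v n assume v: "v \<in> verts D" and n: "n \<in> nk k"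
    have vG: "v \<in> paths G" using v by (simp add: dual_verts_iff)
    let ?B = "{b \<in> paths G. deg G b = n \<and> rng G b = src G v}"
    have bij: "bij_betw (\<lambda>b. v \<cdot> b) ?B {l \<in> paths D. deg D l = n \<and> rng D l = v}"
    proof (rule bij_betwI')
      fix b b' assume b: "b \<in> ?B" "b' \<in> ?B"
      then have "b \<in> paths G" "src G v = rng G b" "b' \<in> paths G" "src G v = rng G b'" by simp_all
      then have "b = b'" if "v \<cdot> b = v \<cdot> b'"
        by (blast dest: factorisation_unique[OF vG _ _ vG _ _ that refl])
      then show "(v \<cdot> b = v \<cdot> b') = (b = b')" by blast
    next
      fix b assume "b \<in> ?B"
      then show "v \<cdot> b \<in> {l \<in> paths D. deg D l = n \<and> rng D l = v}"
        using dual_prefix_path[OF v, of b] dual_deg_prefix[OF v, of b] dual_rng[OF v, of b] by simp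
    next
      fix l assume l: "l \<in> {l \<in> paths D. deg D l = n \<and> rng D l = v}"
      then have "l \<in> paths D" by simp
      then obtain e m where e: "e \<in> verts D" "m \<in> paths G" "src G e = rng G m" "l = e \<cdot> m"
        by (rule dual_prefix_cases)
      have "e = v" "deg G m = n"
        using l e(4) dual_rng[OF e(1-3)] dual_deg_prefix[OF e(1-3)] by auto
      then show "\<exists>b\<in>?B. l = v \<cdot> b" using e by (intro bexI[of _ m]) auto
    qed
    \<comment> \<open>The summation relation of \<open>G\<close> at \<open>src G v\<close>, inserted
      between \<open>s v\<close> and \<open>adj (s v)\<close>, becomes that of \<open>D\<close> at
      \<open>v\<close>: the products \<open>v \<cdot> b\<close> are the paths of dual degree
      \<open>n\<close> and dual range \<open>v\<close>.\<close>
    have "?r v = s v * s (src G v) * adj (s v)"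
      unfolding r_vert[OF v] CK_src_mult[OF ck vG] ..
    also have "\<dots> = (\<Sum>b\<in>?B. s v * (s b * adj (s b)) * adj (s v))"
      unfolding CK_sum[OF ck src_verts[OF vG] n] by (simp add: sum_distrib_left sum_distrib_right)
    also have "\<dots> = (\<Sum>b\<in>?B. s (v \<cdot> b) * adj (s (v \<cdot> b)))"
      using CK_cmp[OF ck vG] by (intro sum.cong refl) (simp add: adj_mult mult.assoc)
    also have "\<dots> = (\<Sum>l\<in>{l \<in> paths D. deg D l = n \<and> rng D l = v}. s l * adj (s l))"
      by (rule sum.reindex_bij_betw[OF bij])
    also have "\<dots> = (\<Sum>l\<in>{l \<in> paths D. deg D l = n \<and> rng D l = v}. ?r l * adj (?r l))"
      by (intro sum.cong refl) (simp add: r_range)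
    finally show "?r v = \<dots>" .
  qed
qed

section \<open>From families for the dual graph back to \<open>G\<close>\<close>

abbreviation range_verts :: "'p \<Rightarrow> 'p set"
  where "range_verts v \<equiv> {e \<in> verts D. rng G e = v}"

text \<open>The formula is forced: if \<open>t\<close> comes from a family \<open>s\<close> for
  \<open>G\<close>, then \<open>t (l \<cdot> e)\<close> is \<open>s l * (s e * adj (s e))\<close>,
  and the summation relation at \<open>src G l\<close> in degree \<open>p\<close> adds these up to
  \<open>s l\<close>.\<close>

definition extend :: "('p \<Rightarrow> 'a::cstar_algebra) \<Rightarrow> 'p \<Rightarrow> 'a"
  where "extend t l = (\<Sum>e\<in>range_verts (src G l). t (l \<cdot> e))"

lemma finite_range_verts:
  assumes "row_finite k G" "v \<in> verts G"
  shows "finite (range_verts v)"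
proof -
  have "range_verts v = {l \<in> paths G. deg G l = p \<and> rng G l = v}"
    by (auto simp: dual_verts_iff)
  then show ?thesis using assms p_nk by (simp add: row_finite_def)
qed

lemma cmp_left_cancel:
  assumes "l \<in> paths G" "e \<in> paths G" "e' \<in> paths G" "src G l = rng G e" "src G l = rng G e'"
    "l \<cdot> e = l \<cdot> e'"
  shows "e = e'"
  using factorisation_unique[OF assms(1,2,4,1,3,5,6) refl] by blast

lemma range_vertsD:
  assumes "l \<in> paths G" "e \<in> range_verts (src G l)"
  shows "e \<in> verts D" "e \<in> paths G" "src G l = rng G e" "l \<cdot> e \<in> paths D"
    "src D (l \<cdot> e) = e" "deg D (l \<cdot> e) = deg G l"
proof -
  show *: "e \<in> verts D" "src G l = rng G e" using assms(2) by auto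
  show "e \<in> paths G" using *(1) by (simp add: dual_verts_iff)
  show "l \<cdot> e \<in> paths D" "src D (l \<cdot> e) = e" "deg D (l \<cdot> e) = deg G l"
    using dual_suffix_path dual_src dual_deg_suffix assms(1) * by blast+
qed

lemma extend_vert: "v \<in> verts G \<Longrightarrow> extend t v = (\<Sum>e\<in>range_verts v. t e)"
  unfolding extend_def src_vert by (intro sum.cong refl) (auto simp: dual_verts_iff cmp_rng)

context
  fixes t :: "'p \<Rightarrow> 'a::cstar_algebra"
  assumes ck: "CK_family k D t" and fin: "row_finite k G"
begin

text \<open>For \<open>e \<noteq> e'\<close> the paths \<open>l \<cdot> e\<close> and
  \<open>l \<cdot> e'\<close> are distinct of equal dual degree, so orthogonality of ranges removes
  the cross terms. The diagonal terms are the source projections \<open>t e\<close>.\<close>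

lemma extend_source:
  assumes l: "l \<in> paths G"
  shows "adj (extend t l) * extend t l = extend t (src G l)"
proof -
  let ?R = "range_verts (src G l)"
  have fR: "finite ?R" by (rule finite_range_verts[OF fin src_verts[OF l]])
  have eq: "adj (t (l \<cdot> e)) * t (l \<cdot> e') = (if e = e' then t e else 0)" if e: "e \<in> ?R" "e' \<in> ?R" for e e'
  proof (cases "e = e'")
    case True
    then show ?thesis using CK_src[OF ck, of "l \<cdot> e"] range_vertsD[OF l e(1)] by simp
  next
    case False
    note d = range_vertsD[OF l e(1)] range_vertsD[OF l e(2)]
    have "l \<cdot> e \<noteq> l \<cdot> e'" using cmp_left_cancel[OF l d(2,8,3,9)] False by blast
    then have "adj (t (l \<cdot> e)) * t (l \<cdot> e') = 0"
      using d by (intro CK_dual_paths_orthogonal[OF ck]) auto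
    then show ?thesis using False by simp
  qed
  have "adj (extend t l) * extend t l = (\<Sum>e\<in>?R. \<Sum>e'\<in>?R. adj (t (l \<cdot> e)) * t (l \<cdot> e'))"
    by (simp only: extend_def adj_sum sum_product)
  also have "\<dots> = (\<Sum>e\<in>?R. \<Sum>e'\<in>?R. if e = e' then t e else 0)"
    by (intro sum.cong refl eq)
  also have "\<dots> = (\<Sum>e\<in>?R. t e)"
    using fR by (intro sum.cong refl) (simp add: sum.delta)
  also have "\<dots> = (\<Sum>e\<in>?R. t (src G l \<cdot> e))"
    by (intro sum.cong refl) (clarsimp simp: dual_verts_iff, metis cmp_rng)
  also have "\<dots> = extend t (src G l)"
    by (simp add: extend_def src_vert[OF src_verts[OF l]])
  finally show ?thesis .
qed

text \<open>Here the cross terms vanish because the source projections \<open>t e\<close> and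
  \<open>t e'\<close> are orthogonal.\<close>

lemma extend_range:
  assumes l: "l \<in> paths G"
  shows "extend t l * adj (extend t l) = (\<Sum>e\<in>range_verts (src G l). t (l \<cdot> e) * adj (t (l \<cdot> e)))"
proof -
  let ?R = "range_verts (src G l)"
  have fR: "finite ?R" by (rule finite_range_verts[OF fin src_verts[OF l]])
  have eq: "t (l \<cdot> e) * adj (t (l \<cdot> e')) = (if e = e' then t (l \<cdot> e) * adj (t (l \<cdot> e)) else 0)"
    if e: "e \<in> ?R" "e' \<in> ?R" for e e'
  proof (cases "e = e'")
    case False
    note d = range_vertsD[OF l e(1)] range_vertsD[OF l e(2)]
    have "t (l \<cdot> e) * adj (t (l \<cdot> e')) = t (l \<cdot> e) * t e * adj (t (l \<cdot> e') * t e')"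
      using CK_src_mult[OF ck d(4)] CK_src_mult[OF ck d(10)] d(5,11) by simp
    also have "\<dots> = t (l \<cdot> e) * (t e * t e') * adj (t (l \<cdot> e'))"
      using CK_vert_adj[OF ck d(7)] by (simp add: adj_mult mult.assoc)
    also have "t e * t e' = 0" by (rule CK_vert_orthogonal[OF ck d(1,7) False])
    finally show ?thesis using False by simp
  qed simp
  have "extend t l * adj (extend t l) = (\<Sum>e\<in>?R. \<Sum>e'\<in>?R. t (l \<cdot> e) * adj (t (l \<cdot> e')))"
    by (simp only: extend_def adj_sum sum_product)
  also have "\<dots> = (\<Sum>e\<in>?R. \<Sum>e'\<in>?R. if e = e' then t (l \<cdot> e) * adj (t (l \<cdot> e)) else 0)"
    by (intro sum.cong refl eq)
  also have "\<dots> = (\<Sum>e\<in>?R. t (l \<cdot> e) * adj (t (l \<cdot> e)))"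
    using fR by (intro sum.cong refl) (simp add: sum.delta)
  finally show ?thesis .
qed

text \<open>Only the summand whose dual source is \<open>rng D m\<close> survives, and
  \<open>dual_cmp\<close> identifies its product with \<open>t m\<close>.\<close>

lemma extend_mult_path:
  assumes l: "l \<in> paths G" and m: "m \<in> paths D" "src G l = rng G m"
  shows "extend t l * t m = t (l \<cdot> m)"
proof -
  let ?R = "range_verts (src G l)"
  have fR: "finite ?R" by (rule finite_range_verts[OF fin src_verts[OF l]])
  have rm: "rng D m \<in> ?R" using dual_rng_verts[OF m(1)] rng_dual_rng[OF m(1)] m(2) by simp
  have eq: "t (l \<cdot> e) * t m = (if e = rng D m then t (l \<cdot> m) else 0)" if e: "e \<in> ?R" for e
  proof (cases "e = rng D m")
    case True
    then show ?thesis
      using CK_cmp[OF ck range_vertsD(4)[OF l e] m(1)] range_vertsD(5)[OF l e] dual_cmp[OF l m] by simp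
  next
    case False
    note d = range_vertsD[OF l e]
    have "t (l \<cdot> e) * t m = t (l \<cdot> e) * t e * (t (rng D m) * t m)"
      using CK_src_mult[OF ck d(4)] d(5) CK_dual_rng_mult[OF ck m(1)] by simp
    also have "\<dots> = t (l \<cdot> e) * (t e * t (rng D m)) * t m"
      by (simp add: mult.assoc)
    also have "t e * t (rng D m) = 0"
      by (rule CK_vert_orthogonal[OF ck d(1) dual_rng_verts[OF m(1)] False])
    finally show ?thesis using False by simp
  qed
  have "extend t l * t m = (\<Sum>e\<in>?R. t (l \<cdot> e) * t m)"
    by (simp only: extend_def sum_distrib_right)
  also have "\<dots> = (\<Sum>e\<in>?R. if e = rng D m then t (l \<cdot> m) else 0)"
    by (intro sum.cong refl eq)
  also have "\<dots> = t (l \<cdot> m)" using fR rm by (simp add: sum.delta')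
  finally show ?thesis .
qed

lemma extend_cmp:
  assumes l: "l \<in> paths G" and m: "m \<in> paths G" "src G l = rng G m"
  shows "extend t (l \<cdot> m) = extend t l * extend t m"
proof -
  have eq: "extend t l * t (m \<cdot> e) = t (l \<cdot> m \<cdot> e)" if e: "e \<in> range_verts (src G m)" for e
  proof -
    note d = range_vertsD[OF m(1) e]
    have "src G l = rng G (m \<cdot> e)" using rng_cmp[OF m(1) d(2,3)] m(2) by simp
    then show ?thesis
      using extend_mult_path[OF l d(4)] cmp_assoc[OF l m(1) d(2) m(2) d(3)] by simp
  qed
  have "extend t l * extend t m = (\<Sum>e\<in>range_verts (src G m). extend t l * t (m \<cdot> e))"
    by (simp only: extend_def[of t m] sum_distrib_left)
  also have "\<dots> = (\<Sum>e\<in>range_verts (src G m). t (l \<cdot> m \<cdot> e))"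
    by (intro sum.cong refl eq)
  also have "\<dots> = extend t (l \<cdot> m)"
    by (simp only: extend_def src_cmp[OF l m])
  finally show ?thesis by simp
qed

text \<open>Both sides are the sum of \<open>t l * adj (t l)\<close> over the paths \<open>l\<close> of degree \<open>n + p\<close> with range
  \<open>v\<close>, grouped by the initial segment of degree \<open>p\<close> and by that of degree \<open>n\<close>, respectively.\<close>
lemma extend_sum:
  assumes v: "v \<in> verts G" and n: "n \<in> nk k"
  shows "extend t v = (\<Sum>l\<in>{l \<in> paths G. deg G l = n \<and> rng G l = v}. extend t l * adj (extend t l))"
proof -
  let ?P = "\<lambda>l. t l * adj (t l)"
  let ?M = "{l \<in> paths D. deg D l = n \<and> rng G l = v}"
  let ?L = "{l \<in> paths G. deg G l = n \<and> rng G l = v}"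
  have "?M \<subseteq> {l \<in> paths G. deg G l = (\<lambda>i. n i + p i) \<and> rng G l = v}"
    by (auto simp: dual_paths_iff dual_deg)
  moreover have "(\<lambda>i. n i + p i) \<in> nk k" using n p_nk by (simp add: nk_def)
  ultimately have finM: "finite ?M" using fin v by (auto simp: row_finite_def intro: finite_subset)
  have finR: "finite (range_verts v)" by (rule finite_range_verts[OF fin v])
  have finL: "finite ?L" using fin v n by (simp add: row_finite_def)
  have "extend t v = (\<Sum>e\<in>range_verts v. \<Sum>l\<in>{l \<in> paths D. deg D l = n \<and> rng D l = e}. ?P l)"
    unfolding extend_vert[OF v] using n by (intro sum.cong refl) (simp add: CK_sum[OF ck])
  also have "\<dots> = (\<Sum>e\<in>range_verts v. \<Sum>l\<in>{l \<in> ?M. rng D l = e}. ?P l)"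
    by (intro sum.cong refl) (auto simp: rng_dual_rng)
  also have "\<dots> = (\<Sum>l\<in>?M. ?P l)"
    using finM finR by (intro sum.group) (auto simp: rng_dual_rng dual_rng_verts)
  also have "\<dots> = (\<Sum>(l, e)\<in>Sigma ?L (\<lambda>l. range_verts (src G l)). ?P (l \<cdot> e))"
  proof -
    have "bij_betw (\<lambda>(l, e). l \<cdot> e) (Sigma ?L (\<lambda>l. range_verts (src G l))) ?M"
    proof (rule bij_betwI')
      fix x y assume x: "x \<in> Sigma ?L (\<lambda>l. range_verts (src G l))"
        and y: "y \<in> Sigma ?L (\<lambda>l. range_verts (src G l))"
      obtain l e l' e' where xy: "x = (l, e)" "y = (l', e')" by fastforce
      have l: "l \<in> paths G" "l' \<in> paths G" "deg G l = deg G l'" using x y xy by auto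
      have e: "e \<in> range_verts (src G l)" "e' \<in> range_verts (src G l')" using x y xy by auto
      have "l = l' \<and> e = e'" if "l \<cdot> e = l' \<cdot> e'"
        by (rule factorisation_unique[OF l(1) range_vertsD(2,3)[OF l(1) e(1)]
            l(2) range_vertsD(2,3)[OF l(2) e(2)] that l(3)])
      then show "((case x of (l, e) \<Rightarrow> l \<cdot> e) = (case y of (l, e) \<Rightarrow> l \<cdot> e)) = (x = y)"
        unfolding xy prod.case by blast
    next
      fix x assume x: "x \<in> Sigma ?L (\<lambda>l. range_verts (src G l))"
      obtain l e where xe: "x = (l, e)" by fastforce
      have l: "l \<in> ?L" and e: "e \<in> range_verts (src G l)" using x xe by auto
      have lG: "l \<in> paths G" using l by simp
      show "(case x of (l, e) \<Rightarrow> l \<cdot> e) \<in> ?M"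
        using range_vertsD[OF lG e] rng_cmp[OF lG] l by (simp add: xe)
    next
      fix m assume m: "m \<in> ?M"
      then have "m \<in> paths D" by simp
      then obtain l e where l: "l \<in> paths G" "e \<in> verts D" "src G l = rng G e" "m = l \<cdot> e"
        by (rule dual_suffix_cases)
      have e: "e \<in> paths G" using l(2) by (simp add: dual_verts_iff)
      have "l \<in> ?L" using m l(1,4) dual_deg_suffix[OF l(1-3)] rng_cmp[OF l(1) e l(3)] by simp
      then show "\<exists>x\<in>Sigma ?L (\<lambda>l. range_verts (src G l)). m = (case x of (l, e) \<Rightarrow> l \<cdot> e)"
        using l(2-4) by (intro bexI[of _ "(l, e)"]) simp_all
    qed
    from sum.reindex_bij_betw[OF this, of ?P] show ?thesis by (simp add: case_prod_unfold)
  qed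
  also have "\<dots> = (\<Sum>l\<in>?L. \<Sum>e\<in>range_verts (src G l). ?P (l \<cdot> e))"
    using finL finite_range_verts[OF fin] src_verts by (intro sum.Sigma[symmetric]) auto
  also have "\<dots> = (\<Sum>l\<in>?L. extend t l * adj (extend t l))"
    by (intro sum.cong refl) (simp add: extend_range)
  finally show ?thesis .
qed

lemma CK_family_extend: "CK_family k G (extend t)"
proof -
  have src_mult: "extend t l * extend t (src G l) = extend t l" if "l \<in> paths G" for l
    using extend_cmp[OF that vert_path[OF src_verts[OF that]]] that
    by (simp add: cmp_src rng_vert src_verts)
  have vert: "adj (extend t v) = extend t v" if "v \<in> verts G" for v
    unfolding extend_vert[OF that] adj_sum by (intro sum.cong refl) (auto simp: CK_vert_adj[OF ck])
  show ?thesis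
    unfolding CK_family_def
  proof (intro conjI ballI impI)
    fix l assume l: "l \<in> paths G"
    show "adj (extend t l) * extend t l = extend t (src G l)" by (rule extend_source[OF l])
    show "extend t l * adj (extend t l) * extend t l = extend t l"
      by (simp only: mult.assoc extend_source[OF l] src_mult[OF l])
  next
    fix v assume v: "v \<in> verts G"
    show "adj (extend t v) = extend t v" by (rule vert[OF v])
    show "extend t v * extend t v = extend t v"
      using src_mult[OF vert_path[OF v]] src_vert[OF v] by simp
    fix w assume w: "w \<in> verts G" "v \<noteq> w"
    show "extend t v * extend t w = 0"
      unfolding extend_vert[OF v] extend_vert[OF w(1)] sum_product
      by (intro sum.neutral ballI) (use w in \<open>auto intro: CK_vert_orthogonal[OF ck]\<close>)
  next
    fix l m assume "l \<in> paths G" "m \<in> paths G" "src G l = rng G m"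
    then show "extend t (l \<cdot> m) = extend t l * extend t m" by (rule extend_cmp)
  next
    fix v n assume "v \<in> verts G" "n \<in> nk k"
    then show "extend t v = (\<Sum>l\<in>{l \<in> paths G. deg G l = n \<and> rng G l = v}. extend t l * adj (extend t l))"
      by (rule extend_sum)
  qed
qed

text \<open>For a dual vertex \<open>e\<close>, the paths \<open>e \<cdot> f\<close> with
  \<open>f\<close> of degree \<open>p\<close> are the paths of dual degree \<open>p\<close> and dual
  range \<open>e\<close>. The summation relation of \<open>D\<close> therefore gives
  \<open>extend t e * adj (extend t e) = t e\<close>, and multiplying by \<open>extend t m\<close>
  on the left yields \<open>t (m \<cdot> e)\<close>.\<close>

lemma extend_restrict:
  assumes l: "l \<in> paths D"
  shows "extend t l * adj (extend t (src D l)) = t l"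
proof -
  obtain m e where m: "m \<in> paths G" "e \<in> verts D" "src G m = rng G e" "l = m \<cdot> e"
    using l by (rule dual_suffix_cases)
  have e: "e \<in> paths G" "e \<in> paths D" "src D l = e"
    using m dual_src[OF m(1-3)] by (auto simp: dual_verts_iff dual_paths_iff)
  note pi = CK_partial_isometry[OF CK_family_extend]
  have "extend t e * adj (extend t e) = (\<Sum>f\<in>range_verts (src G e). t (e \<cdot> f) * adj (t (e \<cdot> f)))"
    by (rule extend_range[OF e(1)])
  also have "\<dots> = (\<Sum>l\<in>{l \<in> paths D. deg D l = p \<and> rng D l = e}. t l * adj (t l))"
  proof (rule sum.reindex_bij_betw[where h = "\<lambda>f. e \<cdot> f"], rule bij_betwI')
    fix f f' assume f: "f \<in> range_verts (src G e)" "f' \<in> range_verts (src G e)"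
    show "(e \<cdot> f = e \<cdot> f') = (f = f')"
      using cmp_left_cancel[OF e(1) range_vertsD(2)[OF e(1) f(1)] range_vertsD(2)[OF e(1) f(2)]
          range_vertsD(3)[OF e(1) f(1)] range_vertsD(3)[OF e(1) f(2)]] by blast
  next
    fix f assume f: "f \<in> range_verts (src G e)"
    note d = range_vertsD[OF e(1) f]
    show "e \<cdot> f \<in> {l \<in> paths D. deg D l = p \<and> rng D l = e}"
      using d(4,6) dual_rng[OF m(2) d(2,3)] m(2) by (simp add: dual_verts_iff)
  next
    fix l assume l: "l \<in> {l \<in> paths D. deg D l = p \<and> rng D l = e}"
    then have "l \<in> paths D" by simp
    then obtain e' f where f: "e' \<in> verts D" "f \<in> paths G" "src G e' = rng G f" "l = e' \<cdot> f"
      by (rule dual_prefix_cases)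
    have "e' = e" "deg G f = p"
      using l f(4) dual_rng[OF f(1-3)] dual_deg_prefix[OF f(1-3)] by auto
    then show "\<exists>f\<in>range_verts (src G e). l = e \<cdot> f"
      using f by (intro bexI[of _ f]) (auto simp: dual_verts_iff)
  qed
  also have "\<dots> = t e" using CK_sum[OF ck m(2) p_nk] by simp
  finally have ee: "extend t e * adj (extend t e) = t e" .
  have "extend t l * adj (extend t e) = extend t m * (extend t e * adj (extend t e))"
    unfolding m(4) extend_cmp[OF m(1) e(1) m(3)] by (simp only: mult.assoc)
  also have "\<dots> = t l"
    unfolding ee m(4) by (rule extend_mult_path[OF m(1) e(2) m(3)])
  finally show ?thesis using e(3) by simp
qed

end

lemma restrict_extend:
  fixes s :: "'p \<Rightarrow> 'a::cstar_algebra"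
  assumes ck: "CK_family k G s" and l: "l \<in> paths G"
  shows "extend (\<lambda>l. s l * adj (s (src D l))) l = s l"
proof -
  have eq: "s (l \<cdot> e) * adj (s (src D (l \<cdot> e))) = s l * (s e * adj (s e))"
    if "e \<in> range_verts (src G l)" for e
    using that CK_cmp[OF ck l, of e] dual_src[OF l, of e] by (simp add: dual_verts_iff mult.assoc)
  have "extend (\<lambda>l. s l * adj (s (src D l))) l = (\<Sum>e\<in>range_verts (src G l). s l * (s e * adj (s e)))"
    unfolding extend_def by (intro sum.cong refl eq)
  also have "\<dots> = s l * (\<Sum>e\<in>{e \<in> paths G. deg G e = p \<and> rng G e = src G l}. s e * adj (s e))"
    unfolding sum_distrib_left by (intro sum.cong) (auto simp: dual_verts_iff)
  also have "\<dots> = s l"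
    using CK_sum[OF ck src_verts[OF l] p_nk] CK_src_mult[OF ck l] by simp
  finally show ?thesis .
qed

end

theorem theorem3p5:
  fixes k :: nat and G :: "'p kgraph" and p :: "nat \<Rightarrow> nat"
    and s :: "'p \<Rightarrow> 'a::cstar_algebra" and t :: "'p \<Rightarrow> 'b::cstar_algebra"
  assumes "is_kgraph k G" and "row_finite k G" and "no_sources k G" and "p \<in> nk k"
    and "universal_CK k G s TYPE('a)" and "universal_CK k G s TYPE('b)"
    and "universal_CK k (dual G p) t TYPE('a)" and "universal_CK k (dual G p) t TYPE('b)"
  shows "\<exists>\<phi> :: 'b \<Rightarrow> 'a. star_hom \<phi> \<and> bij \<phi> \<and>
           (\<forall>l\<in>paths (dual G p). \<phi> (t l) = s l * adj (s (src (dual G p) l)))"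
proof -
  interpret dual_kgraph k G p
    using assms(1,4) by unfold_locales
  have s: "CK_family k G s" "cstar_gen (s ` paths G) = UNIV"
    and t: "CK_family k D t" "cstar_gen (t ` paths D) = UNIV"
    using assms(5,7) by (simp_all add: universal_CK_def)
  \<comment> \<open>Universality is stated for one target algebra at a time: \<open>\<phi>\<close>
    comes from that of \<open>t\<close> with target \<open>'a\<close>, and \<open>\<psi>\<close>
    from that of \<open>s\<close> with target \<open>'b\<close>.\<close>
  obtain \<phi> :: "'b \<Rightarrow> 'a" where \<phi>: "star_hom \<phi>" "\<And>l. l \<in> paths D \<Longrightarrow> \<phi> (t l) = s l * adj (s (src D l))"
    using assms(7) CK_family_restrict[OF s(1)] unfolding universal_CK_def by blast
  obtain \<psi> :: "'a \<Rightarrow> 'b" where \<psi>: "star_hom \<psi>" "\<And>l. l \<in> paths G \<Longrightarrow> \<psi> (s l) = extend t l"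
    using assms(6) CK_family_extend[OF t(1) assms(2)] unfolding universal_CK_def by blast
  have \<phi>_extend: "\<phi> (extend t l) = s l" if l: "l \<in> paths G" for l
  proof -
    have "\<phi> (extend t l) = (\<Sum>e\<in>range_verts (src G l). \<phi> (t (l \<cdot> e)))"
      unfolding extend_def by (rule star_hom_sum[OF \<phi>(1)])
    also have "\<dots> = extend (\<lambda>l. s l * adj (s (src D l))) l"
      unfolding extend_def by (intro sum.cong refl \<phi>(2) range_vertsD(4)[OF l])
    finally show ?thesis using restrict_extend[OF s(1) l] by simp
  qed
  \<comment> \<open>Both composites are homomorphisms fixing a generating family, hence identities
    by \<open>star_hom_eq_on_gen\<close>.\<close>
  have "(\<lambda>x. \<phi> (\<psi> x)) = (\<lambda>x. x)"
    by (rule star_hom_eq_on_gen[OF star_hom_comp[OF \<phi>(1) \<psi>(1)] _ s(2)])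
      (auto simp: star_hom_def \<psi>(2) \<phi>_extend)
  moreover have "\<psi> (\<phi> (t l)) = t l" if l: "l \<in> paths D" for l
  proof -
    have "src D l \<in> paths G" using dual_src_verts[OF l] by (simp add: dual_verts_iff)
    then have "\<psi> (\<phi> (t l)) = extend t l * adj (extend t (src D l))"
      using \<psi> \<phi>(2)[OF l] dual_path[OF l] by (simp add: star_hom_def)
    then show ?thesis using extend_restrict[OF t(1) assms(2) l] by simp
  qed
  then have "(\<lambda>x. \<psi> (\<phi> x)) = (\<lambda>x. x)"
    by (intro star_hom_eq_on_gen[OF star_hom_comp[OF \<psi>(1) \<phi>(1)] _ t(2)]) (auto simp: star_hom_def)
  ultimately have "bij \<phi>"
    by (intro o_bij[of \<psi>]) (auto simp: fun_eq_iff)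
  then show ?thesis using \<phi> by blast
qed

end
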